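(* Let $\mathbf{x}=(x_1,\dots,x_r)$. Let $T_1=\bigcup_{i=1}^a S_i$ and $T_2=\bigcup_{j=1}^b S'_j$, where each $S_i$ and $S'_j$ is a closed basic semialgebraic set in $\mathbb{R}^r$ given by a finite list of polynomial inequalities, $S=\{\mathbf{x}\mid p_1(\mathbf{x})\ge0,\dots,p_m(\mathbf{x})\ge0\}$. For such a set define $\tilde S=\{(x_0,\mathbf{x})\in\mathbb{R}^{r+1}\mid \tilde p_1(x_0,\mathbf{x})\ge0,\dots,\tilde p_m(x_0,\mathbf{x})\ge0,\ x_0\ge0,\ x_0^2+\|\mathbf{x}\|^2=1\}$, and let $\tilde T_1=\bigcup_{i=1}^a\tilde S_i$, $\tilde T_2=\bigcup_{j=1}^b\tilde S'_j$. Assume $\tilde T_1\cap\tilde T_2=\emptyset$. Then there exist polynomials $h_1,h_2\in\mathbb{R}[\mathbf{x}]$ such that $h(\mathbf{x})=h_1(\mathbf{x})+\sqrt{\|\mathbf{x}\|^2+1}\,h_2(\mathbf{x})$ satisfies $h(\mathbf{x})>0$ for all $\mathbf{x}\in T_1$ and $-h(\mathbf{x})>0$ for all $\mathbf{x}\in T_2$.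
   Context: For $f\in\mathbb{R}[\mathbf{x}]$ of total degree $d_f$, $\tilde f(x_0,\mathbf{x})=x_0^{d_f}f(x_1/x_0,\dots,x_r/x_0)$ is its homogenization with a fresh variable $x_0$. Note $\tilde S$ depends on the given defining polynomials of $S$. *)

theory Defs
  imports "HOL-Analysis.Analysis" "HOL-Library.Poly_Mapping"
begin

text \<open>Real polynomials in the variables \<^typ>\<open>'v\<close>: finitely supported coefficient families indexed by
  exponent vectors.\<close>

type_synonym 'v rpoly = "('v \<Rightarrow>\<^sub>0 nat) \<Rightarrow>\<^sub>0 real"

definition monom_eval :: "('v \<Rightarrow> real) \<Rightarrow> ('v \<Rightarrow>\<^sub>0 nat) \<Rightarrow> real" where
  "monom_eval x m = (\<Prod>i\<in>Poly_Mapping.keys m. x i ^ Poly_Mapping.lookup m i)"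

definition poly_eval :: "('v \<Rightarrow> real) \<Rightarrow> 'v rpoly \<Rightarrow> real" where
  "poly_eval x p = (\<Sum>m\<in>Poly_Mapping.keys p. Poly_Mapping.lookup p m * monom_eval x m)"

definition monom_degree :: "('v \<Rightarrow>\<^sub>0 nat) \<Rightarrow> nat" where
  "monom_degree m = (\<Sum>i\<in>Poly_Mapping.keys m. Poly_Mapping.lookup m i)"

text \<open>The inserted \<open>0\<close> only serves to give the zero polynomial the degree \<open>0\<close>.\<close>

definition total_degree :: "'v rpoly \<Rightarrow> nat" where
  "total_degree p = Max (insert 0 (monom_degree ` Poly_Mapping.keys p))"

text \<open>Homogenization: \<^const>\<open>None\<close> is the fresh variable \<open>x\<^sub>0\<close>, and \<open>Some i\<close> is the old variable \<open>i\<close>.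
  A monomial \<open>m\<close> of a polynomial of degree \<open>d\<close> becomes \<open>x\<^sub>0\<close> to the power \<open>d - deg m\<close>, times \<open>m\<close>.\<close>

definition homogenize_monom :: "nat \<Rightarrow> ('v \<Rightarrow>\<^sub>0 nat) \<Rightarrow> ('v option \<Rightarrow>\<^sub>0 nat)" where
  "homogenize_monom d m =
     Poly_Mapping.single None (d - monom_degree m)
     + (\<Sum>i\<in>Poly_Mapping.keys m. Poly_Mapping.single (Some i) (Poly_Mapping.lookup m i))"

definition homogenize :: "'v rpoly \<Rightarrow> 'v option rpoly" where
  "homogenize p =
     (\<Sum>m\<in>Poly_Mapping.keys p.
        Poly_Mapping.single (homogenize_monom (total_degree p) m) (Poly_Mapping.lookup p m))"

text \<open>The closed basic semialgebraic set is represented by its list of defining polynomials, since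
  its homogenized counterpart depends on them. A point of the latter is a pair \<open>(x\<^sub>0, x)\<close>.\<close>

definition basic_set :: "'n rpoly list \<Rightarrow> (real ^ 'n) set" where
  "basic_set ps = {x. \<forall>p\<in>set ps. poly_eval (\<lambda>i. x $ i) p \<ge> 0}"

definition hom_basic_set :: "'n rpoly list \<Rightarrow> (real \<times> (real ^ 'n)) set" where
  "hom_basic_set ps =
     {(x0, x). (\<forall>p\<in>set ps. poly_eval (case_option x0 (\<lambda>i. x $ i)) (homogenize p) \<ge> 0)
        \<and> x0 \<ge> 0 \<and> x0\<^sup>2 + (norm x)\<^sup>2 = 1}"

lemma monom_eval_superset:
  assumes "finite A" "Poly_Mapping.keys m \<subseteq> A"
  shows "monom_eval x m = (\<Prod>i\<in>A. x i ^ Poly_Mapping.lookup m i)"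
  unfolding monom_eval_def
  by (rule prod.mono_neutral_left) (use assms in \<open>auto simp: in_keys_iff\<close>)

lemma monom_eval_0 [simp]: "monom_eval x 0 = 1"
  by (simp add: monom_eval_def)

lemma monom_eval_single [simp]: "monom_eval x (Poly_Mapping.single i k) = x i ^ k"
  by (cases "k = 0") (simp_all add: monom_eval_def)

lemma monom_eval_add: "monom_eval x (m + n) = monom_eval x m * monom_eval x n"
proof -
  let ?A = "Poly_Mapping.keys m \<union> Poly_Mapping.keys n"
  have "Poly_Mapping.keys (m + n) \<subseteq> ?A"
    by (rule Poly_Mapping.keys_add)
  then show ?thesis
    by (simp add: monom_eval_superset[of ?A] lookup_add power_add prod.distrib)
qed

lemma monom_eval_sum:
  "finite I \<Longrightarrow> monom_eval x (\<Sum>i\<in>I. f i) = (\<Prod>i\<in>I. monom_eval x (f i))"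
  by (induction I rule: finite_induct) (simp_all add: monom_eval_add)

lemma poly_eval_superset:
  assumes "finite A" "Poly_Mapping.keys p \<subseteq> A"
  shows "poly_eval x p = (\<Sum>m\<in>A. Poly_Mapping.lookup p m * monom_eval x m)"
  unfolding poly_eval_def
  by (rule sum.mono_neutral_left) (use assms in \<open>auto simp: in_keys_iff\<close>)

lemma poly_eval_0 [simp]: "poly_eval x 0 = 0"
  by (simp add: poly_eval_def)

lemma poly_eval_single [simp]: "poly_eval x (Poly_Mapping.single m c) = c * monom_eval x m"
  by (cases "c = 0") (simp_all add: poly_eval_def)

lemma poly_eval_add: "poly_eval x (p + q) = poly_eval x p + poly_eval x q"
proof -
  let ?A = "Poly_Mapping.keys p \<union> Poly_Mapping.keys q"
  have "Poly_Mapping.keys (p + q) \<subseteq> ?A"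
    by (rule Poly_Mapping.keys_add)
  then show ?thesis
    by (simp add: poly_eval_superset[of ?A] lookup_add distrib_right sum.distrib)
qed

lemma poly_eval_sum:
  "finite I \<Longrightarrow> poly_eval x (\<Sum>i\<in>I. f i) = (\<Sum>i\<in>I. poly_eval x (f i))"
  by (induction I rule: finite_induct) (simp_all add: poly_eval_add)

lemma monom_degree_le_total_degree:
  "m \<in> Poly_Mapping.keys p \<Longrightarrow> monom_degree m \<le> total_degree p"
  unfolding total_degree_def by (intro Max_ge) auto

lemma poly_eval_homogenize:
  assumes "x0 \<noteq> 0"
  shows "poly_eval (case_option x0 x) (homogenize p)
           = x0 ^ total_degree p * poly_eval (\<lambda>i. x i / x0) p"
proof -
  have *: "monom_eval (case_option x0 x) (homogenize_monom (total_degree p) m)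
             = x0 ^ total_degree p * monom_eval (\<lambda>i. x i / x0) m"
    if m: "m \<in> Poly_Mapping.keys p" for m
  proof -
    have "x0 ^ total_degree p = x0 ^ (total_degree p - monom_degree m) * x0 ^ monom_degree m"
      using monom_degree_le_total_degree[OF m] by (simp flip: power_add)
    moreover have "x0 ^ monom_degree m = (\<Prod>i\<in>Poly_Mapping.keys m. x0 ^ Poly_Mapping.lookup m i)"
      by (simp add: monom_degree_def power_sum)
    ultimately show ?thesis
      using assms
      by (simp add: homogenize_monom_def monom_eval_add monom_eval_sum)
        (simp add: monom_eval_def mult.assoc power_divide flip: prod.distrib)
  qed
  show ?thesis
    unfolding homogenize_def
    by (simp add: poly_eval_sum * poly_eval_def[of _ p] sum_distrib_left ac_simps)
qed

end

theory Submission
  imports Defs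
begin

text \<open>The homogenized sets are compact and disjoint, so by Urysohn and Stone--Weierstrass a
  polynomial \<open>g\<close> on \<open>\<real>\<^sup>r\<^sup>+\<^sup>1\<close> separates them. With \<open>s = \<surd>(\<parallel>x\<parallel>\<^sup>2 + 1)\<close>, central projection
  \<open>x \<mapsto> (1/s, x/s)\<close> maps \<open>T\<^sub>i\<close> into the \<open>i\<close>-th homogenized set, and clearing denominators in
  \<open>g(1/s, x/s)\<close> by a power of \<open>s\<close> leaves a polynomial in \<open>x\<close> and \<open>s\<close>, which is linear in \<open>s\<close> after
  substituting \<open>s\<^sup>2 = \<parallel>x\<parallel>\<^sup>2 + 1\<close>.\<close>

text \<open>Only values matter below, so polynomials are treated as functions; coefficient families
  are recovered at the very end.\<close>

definition poly_fun :: "(real ^ 'n \<Rightarrow> real) \<Rightarrow> bool" where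
  "poly_fun f \<longleftrightarrow> (\<exists>p. \<forall>x. f x = poly_eval (\<lambda>i. x $ i) p)"

lemma poly_fun_const: "poly_fun (\<lambda>x. c)"
  unfolding poly_fun_def by (rule exI[of _ "Poly_Mapping.single 0 c"]) simp

lemma poly_fun_component: "poly_fun (\<lambda>x. x $ i)"
  unfolding poly_fun_def
  by (rule exI[of _ "Poly_Mapping.single (Poly_Mapping.single i 1) 1"]) simp

lemma poly_fun_add: "poly_fun f \<Longrightarrow> poly_fun g \<Longrightarrow> poly_fun (\<lambda>x. f x + g x)"
  unfolding poly_fun_def by (metis poly_eval_add)

text \<open>The witness is the product expanded over pairs of monomials; evaluation turns sums of
  exponents into products.\<close>

lemma poly_eval_mult_ex: "\<exists>r. \<forall>x. poly_eval x r = poly_eval x p * poly_eval x q"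
proof
  let ?r = "\<Sum>m\<in>Poly_Mapping.keys p. \<Sum>n\<in>Poly_Mapping.keys q.
    Poly_Mapping.single (m + n) (Poly_Mapping.lookup p m * Poly_Mapping.lookup q n)"
  show "\<forall>x. poly_eval x ?r = poly_eval x p * poly_eval x q"
    by (simp add: poly_eval_sum monom_eval_add poly_eval_def[of _ p] poly_eval_def[of _ q]
        sum_product ac_simps)
qed

lemma poly_fun_mult: "poly_fun f \<Longrightarrow> poly_fun g \<Longrightarrow> poly_fun (\<lambda>x. f x * g x)"
  unfolding poly_fun_def by (metis poly_eval_mult_ex)

lemma poly_fun_sum: "finite I \<Longrightarrow> (\<And>i. i \<in> I \<Longrightarrow> poly_fun (f i)) \<Longrightarrow> poly_fun (\<lambda>x. \<Sum>i\<in>I. f i x)"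
  by (induction I rule: finite_induct) (simp_all add: poly_fun_const poly_fun_add)

lemma poly_fun_norm_sq: "poly_fun (\<lambda>x :: real ^ 'n::finite. (norm x)\<^sup>2)"
proof -
  have "(norm x)\<^sup>2 = (\<Sum>i\<in>UNIV. x $ i * x $ i)" for x :: "real ^ 'n"
    by (simp add: power2_norm_eq_inner inner_vec_def)
  then show ?thesis
    by (simp only:) (intro poly_fun_sum poly_fun_mult poly_fun_component finite)
qed

abbreviation (input) proj_scale :: "real ^ 'n::finite \<Rightarrow> real" where
  "proj_scale x \<equiv> sqrt ((norm x)\<^sup>2 + 1)"

lemma proj_scale_pos: "proj_scale x > 0"
  by (simp add: add_nonneg_pos)

text \<open>The ring obtained by adjoining \<open>s = proj_scale x\<close> to the polynomial
  functions, with elements in the normal form required of \<open>h\<close>.\<close>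

definition sqrt_poly_fun :: "(real ^ 'n::finite \<Rightarrow> real) \<Rightarrow> bool" where
  "sqrt_poly_fun f \<longleftrightarrow>
     (\<exists>f1 f2. poly_fun f1 \<and> poly_fun f2 \<and> (\<forall>x. f x = f1 x + proj_scale x * f2 x))"

lemma sqrt_poly_fun_poly_fun: "poly_fun f \<Longrightarrow> sqrt_poly_fun f"
  unfolding sqrt_poly_fun_def
  by (intro exI[of _ f] exI[of _ "\<lambda>x. 0"]) (simp add: poly_fun_const)

lemma sqrt_poly_fun_proj_scale: "sqrt_poly_fun proj_scale"
  unfolding sqrt_poly_fun_def
  by (intro exI[of _ "\<lambda>x. 0"] exI[of _ "\<lambda>x. 1"]) (simp add: poly_fun_const)

lemma sqrt_poly_fun_add:
  assumes "sqrt_poly_fun f" "sqrt_poly_fun g"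
  shows "sqrt_poly_fun (\<lambda>x. f x + g x)"
proof -
  obtain f1 f2 g1 g2 where "poly_fun f1" "poly_fun f2" "poly_fun g1" "poly_fun g2"
    and "\<And>x. f x = f1 x + proj_scale x * f2 x" "\<And>x. g x = g1 x + proj_scale x * g2 x"
    using assms unfolding sqrt_poly_fun_def by blast
  then show ?thesis
    unfolding sqrt_poly_fun_def
    by (intro exI[of _ "\<lambda>x. f1 x + g1 x"] exI[of _ "\<lambda>x. f2 x + g2 x"])
      (simp add: poly_fun_add algebra_simps)
qed

text \<open>The only term outside the normal form carries \<open>s^2\<close>, which equals the
  polynomial \<open>(norm x)^2 + 1\<close> and so moves into the first component.\<close>

lemma sqrt_poly_fun_mult:
  assumes "sqrt_poly_fun f" "sqrt_poly_fun g"
  shows "sqrt_poly_fun (\<lambda>x. f x * g x)"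
proof -
  obtain f1 f2 g1 g2 where P: "poly_fun f1" "poly_fun f2" "poly_fun g1" "poly_fun g2"
    and f: "\<And>x. f x = f1 x + proj_scale x * f2 x"
    and g: "\<And>x. g x = g1 x + proj_scale x * g2 x"
    using assms unfolding sqrt_poly_fun_def by blast
  have "f x * g x = (f1 x * g1 x + ((norm x)\<^sup>2 + 1) * (f2 x * g2 x))
      + proj_scale x * (f1 x * g2 x + f2 x * g1 x)" for x
  proof -
    have "(norm x)\<^sup>2 + 1 = proj_scale x * proj_scale x"
      by simp
    then show ?thesis
      unfolding f g by algebra
  qed
  moreover have "poly_fun (\<lambda>x. f1 x * g1 x + ((norm x)\<^sup>2 + 1) * (f2 x * g2 x))"
    "poly_fun (\<lambda>x. f1 x * g2 x + f2 x * g1 x)"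
    by (intro poly_fun_add poly_fun_mult poly_fun_const poly_fun_norm_sq P)+
  ultimately show ?thesis
    unfolding sqrt_poly_fun_def by blast
qed

lemma sqrt_poly_fun_proj_scale_power: "sqrt_poly_fun (\<lambda>x. proj_scale x ^ k)"
  by (induction k)
    (simp_all add: sqrt_poly_fun_mult sqrt_poly_fun_proj_scale sqrt_poly_fun_poly_fun poly_fun_const)

text \<open>This is \<open>(1, x)\<close> divided by its norm: the point where the ray from the
  origin through \<open>(1, x)\<close> meets the unit sphere.\<close>

definition central_proj :: "real ^ 'n::finite \<Rightarrow> real \<times> (real ^ 'n)" where
  "central_proj x = (1 / proj_scale x, (1 / proj_scale x) *\<^sub>R x)"

text \<open>Setting the extra coordinate to 1 makes a linear form affine in \<open>x\<close>, as
  expansion in the standard basis shows.\<close>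

lemma poly_fun_linear_affine:
  fixes f :: "real \<times> (real ^ 'n::finite) \<Rightarrow> real"
  assumes "linear f"
  shows "poly_fun (\<lambda>x. f (1, x))"
proof -
  have "f (1, x) = f (1, 0) + (\<Sum>i\<in>UNIV. x $ i * f (0, axis i 1))" for x
  proof -
    have "(0, x) = (\<Sum>i\<in>UNIV. x $ i *\<^sub>R (0 :: real, axis i 1 :: real ^ 'n))"
      using basis_expansion[of x]
      by (simp add: prod_eq_iff fst_sum snd_sum scalar_mult_eq_scaleR)
    then have "f (0, x) = (\<Sum>i\<in>UNIV. x $ i * f (0, axis i 1))"
      by (simp add: linear_sum[OF assms] linear_scale[OF assms] del: scaleR_Pair)
    then show ?thesis
      using linear_add[OF assms, of "(1, 0)" "(0, x)"] by simp
  qed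
  then have "(\<lambda>x. f (1, x)) = (\<lambda>x. f (1, 0) + (\<Sum>i\<in>UNIV. x $ i * f (0, axis i 1)))"
    by (rule ext)
  then show ?thesis
    by (simp only:) (intro poly_fun_sum poly_fun_add poly_fun_mult poly_fun_component
        poly_fun_const finite)
qed

text \<open>Induction on how \<open>g\<close> is built from linear forms and constants. As
  \<open>k\<close> is merely existential, no degree has to be tracked.\<close>

lemma real_polynomial_function_clear_denominators:
  fixes g :: "real \<times> (real ^ 'n::finite) \<Rightarrow> real"
  assumes "real_polynomial_function g"
  shows "\<exists>k. sqrt_poly_fun (\<lambda>x. proj_scale x ^ k * g (central_proj x))"
  using assms
proof (induction rule: real_polynomial_function.induct)
  case (linear f)
  then interpret bounded_linear f .
  \<comment> \<open>A linear form is homogeneous of degree 1, so one factor of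
    \<open>proj_scale x\<close> cancels the scaling exactly.\<close>
  have "proj_scale x ^ 1 * f (central_proj x) = f (1, x)" for x
  proof -
    have "central_proj x = (1 / proj_scale x) *\<^sub>R (1, x)"
      by (simp add: central_proj_def)
    then show ?thesis
      using proj_scale_pos[of x] by (simp only: scaleR) simp
  qed
  then show ?case
    using sqrt_poly_fun_poly_fun[OF poly_fun_linear_affine[OF linear_axioms]]
    by (intro exI[of _ 1]) presburger
next
  case (const c)
  then show ?case
    by (intro exI[of _ 0]) (simp add: sqrt_poly_fun_poly_fun poly_fun_const)
next
  case (add f g)
  then obtain k l where
    "sqrt_poly_fun (\<lambda>x. proj_scale x ^ k * f (central_proj x))"
    "sqrt_poly_fun (\<lambda>x. proj_scale x ^ l * g (central_proj x))"
    by blast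
  \<comment> \<open>Cross-multiplication brings both summands to the exponent \<open>k + l\<close>;
    the extra powers stay in the ring.\<close>
  then have "sqrt_poly_fun (\<lambda>x.
      proj_scale x ^ l * (proj_scale x ^ k * f (central_proj x))
      + proj_scale x ^ k * (proj_scale x ^ l * g (central_proj x)))"
    using sqrt_poly_fun_add sqrt_poly_fun_mult sqrt_poly_fun_proj_scale_power by blast
  then show ?case
    by (intro exI[of _ "k + l"]) (simp add: power_add algebra_simps)
next
  case (mult f g)
  then obtain k l where
    "sqrt_poly_fun (\<lambda>x. proj_scale x ^ k * f (central_proj x))"
    "sqrt_poly_fun (\<lambda>x. proj_scale x ^ l * g (central_proj x))"
    by blast
  then have "sqrt_poly_fun (\<lambda>x.
      (proj_scale x ^ k * f (central_proj x)) * (proj_scale x ^ l * g (central_proj x)))"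
    by (rule sqrt_poly_fun_mult)
  then show ?case
    by (intro exI[of _ "k + l"]) (simp add: power_add algebra_simps)
qed

text \<open>At a point with \<open>x0 > 0\<close>, the homogenization is a positive power of
  \<open>x0\<close> times the polynomial at the rescaled point. Here rescaling gives back
  \<open>x\<close>, so the inequalities carry over.\<close>

lemma central_proj_in_hom_basic_set:
  assumes "x \<in> basic_set ps"
  shows "central_proj x \<in> hom_basic_set ps"
proof -
  have pos: "1 / proj_scale x > 0"
    using proj_scale_pos[of x] by simp
  have "poly_eval (case_option (1 / proj_scale x) (\<lambda>i. ((1 / proj_scale x) *\<^sub>R x) $ i))
      (homogenize p) \<ge> 0" if "p \<in> set ps" for p
  proof -
    have "(\<lambda>i. ((1 / proj_scale x) *\<^sub>R x) $ i / (1 / proj_scale x)) = (\<lambda>i. x $ i)"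
      using proj_scale_pos[of x] by (auto simp: fun_eq_iff)
    moreover have "poly_eval (\<lambda>i. x $ i) p \<ge> 0"
      using assms that by (simp add: basic_set_def)
    ultimately show ?thesis
      using pos by (subst poly_eval_homogenize) auto
  qed
  moreover have "(1 / proj_scale x)\<^sup>2 + (norm ((1 / proj_scale x) *\<^sub>R x))\<^sup>2 = 1"
  proof -
    have "(norm x)\<^sup>2 + 1 \<noteq> 0"
      by (metis add_nonneg_pos less_irrefl zero_le_power2 zero_less_one)
    then show ?thesis
      by (simp add: power_divide add_divide_distrib[symmetric])
  qed
  ultimately show ?thesis
    using less_imp_le[OF pos]
    unfolding hom_basic_set_def central_proj_def mem_Collect_eq prod.case by blast
qed

lemma continuous_on_poly_eval:
  assumes "\<And>v. continuous_on S (\<lambda>y. f y v)"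
  shows "continuous_on S (\<lambda>y. poly_eval (f y) p)"
  unfolding poly_eval_def monom_eval_def
  by (intro continuous_intros assms)

text \<open>All conditions are closed and the set lies on the unit sphere. This is the gain over
  \<open>basic_set\<close>, which may be unbounded.\<close>

lemma compact_hom_basic_set: "compact (hom_basic_set (ps :: 'n::finite rpoly list))"
proof -
  have cont: "continuous_on UNIV
      (\<lambda>y. poly_eval (case_option (fst y) (\<lambda>i. snd y $ i)) p)" for p :: "'n option rpoly"
  proof (rule continuous_on_poly_eval)
    show "continuous_on UNIV (\<lambda>y. case_option (fst y) (\<lambda>i. snd y $ i) v)" for v :: "'n option"
      by (cases v) (auto intro!: continuous_intros)
  qed
  have eq: "hom_basic_set ps =
     (\<Inter>p\<in>set ps. {y. poly_eval (case_option (fst y) (\<lambda>i. snd y $ i)) (homogenize p) \<ge> 0})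
     \<inter> {y. fst y \<ge> 0} \<inter> {y. (fst y)\<^sup>2 + (norm (snd y))\<^sup>2 = 1}"
    by (auto simp: hom_basic_set_def)
  have "closed (hom_basic_set ps)"
    unfolding eq
    by (intro closed_Int closed_INT ballI closed_Collect_le closed_Collect_eq cont
        continuous_intros)
  moreover have "bounded (hom_basic_set ps)"
    unfolding bounded_iff
    by (intro exI[of _ 1]) (auto simp: hom_basic_set_def norm_Pair)
  ultimately show ?thesis
    by (simp add: compact_eq_bounded_closed)
qed

text \<open>A continuous function equal to 1 on \<open>S\<close> and -1 on \<open>T\<close> keeps
  its signs under an approximation with error strictly below 1.\<close>

lemma compact_separation_real_polynomial_function:
  fixes S T :: "'a::euclidean_space set"
  assumes "compact S" "compact T" "S \<inter> T = {}"
  obtains g where "real_polynomial_function g"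
    "\<And>x. x \<in> S \<Longrightarrow> g x > 0" "\<And>x. x \<in> T \<Longrightarrow> g x < 0"
proof -
  obtain f :: "'a \<Rightarrow> real" where f: "continuous_on UNIV f"
    "\<And>x. x \<in> S \<Longrightarrow> f x = 1" "\<And>x. x \<in> T \<Longrightarrow> f x = -1"
    using Urysohn[of S T 1 "-1"] assms compact_imp_closed by metis
  have "compact (S \<union> T)" "continuous_on (S \<union> T) f"
    using assms f(1) by (auto intro: compact_Un continuous_on_subset)
  then obtain g where g: "real_polynomial_function g" "\<And>x. x \<in> S \<union> T \<Longrightarrow> \<bar>f x - g x\<bar> < 1"
    using Stone_Weierstrass_real_polynomial_function[of "S \<union> T" f 1] by auto
  show thesis
  proof (rule that[OF g(1)])
    show "g x > 0" if "x \<in> S" for x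
      using g(2)[of x] f(2)[of x] that by auto
    show "g x < 0" if "x \<in> T" for x
      using g(2)[of x] f(3)[of x] that by auto
  qed
qed

theorem theorem2:
  fixes a b :: nat
    and p q :: "nat \<Rightarrow> ('n::finite) rpoly list"
  assumes "(\<Union>i\<in>{1..a}. hom_basic_set (p i)) \<inter> (\<Union>j\<in>{1..b}. hom_basic_set (q j)) = {}"
  shows "\<exists>h1 h2 :: 'n rpoly.
           let h = (\<lambda>x :: real ^ 'n. poly_eval (\<lambda>i. x $ i) h1
                      + sqrt ((norm x)\<^sup>2 + 1) * poly_eval (\<lambda>i. x $ i) h2)
           in (\<forall>x \<in> (\<Union>i\<in>{1..a}. basic_set (p i)). h x > 0)
            \<and> (\<forall>x \<in> (\<Union>j\<in>{1..b}. basic_set (q j)). - h x > 0)"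
proof -
  obtain g where g: "real_polynomial_function g"
    "\<And>y. y \<in> (\<Union>i\<in>{1..a}. hom_basic_set (p i)) \<Longrightarrow> g y > 0"
    "\<And>y. y \<in> (\<Union>j\<in>{1..b}. hom_basic_set (q j)) \<Longrightarrow> g y < 0"
    by (rule compact_separation_real_polynomial_function[OF _ _ assms])
      (auto intro!: compact_UN compact_hom_basic_set)
  obtain k where "sqrt_poly_fun (\<lambda>x. proj_scale x ^ k * g (central_proj x))"
    using real_polynomial_function_clear_denominators[OF g(1)] by blast
  \<comment> \<open>The two components of the normal form are polynomial functions;
    \<open>h1\<close> and \<open>h2\<close> are coefficient families representing them.\<close>
  then obtain h1 h2 :: "'n rpoly" where h: "\<And>x. poly_eval (\<lambda>i. x $ i) h1
      + proj_scale x * poly_eval (\<lambda>i. x $ i) h2 = proj_scale x ^ k * g (central_proj x)"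
    unfolding sqrt_poly_fun_def poly_fun_def by metis
  \<comment> \<open>The cleared factor is positive, so \<open>h\<close> has at \<open>x\<close> the
    sign that \<open>g\<close> has at the projected point.\<close>
  have "proj_scale x ^ k * g (central_proj x) > 0"
    if "x \<in> (\<Union>i\<in>{1..a}. basic_set (p i))" for x
    using that g(2) central_proj_in_hom_basic_set proj_scale_pos[of x]
    by (intro mult_pos_pos zero_less_power) blast+
  moreover have "- (proj_scale x ^ k * g (central_proj x)) > 0"
    if "x \<in> (\<Union>j\<in>{1..b}. basic_set (q j))" for x
  proof -
    have "g (central_proj x) < 0"
      using that g(3) central_proj_in_hom_basic_set by blast
    then show ?thesis
      using proj_scale_pos[of x] by (simp add: mult_pos_neg)
  qed
  ultimately show ?thesis
    unfolding Let_def by (intro exI[of _ h1] exI[of _ h2]) (simp only: h, blast)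
qed

end
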